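(* For every distributive inverse semigroup $A$ there exist a set $X$ and an injective homomorphism of distributive inverse semigroups $\rho\colon A\hookrightarrow\mathcal{I}(X)$; that is, every distributive inverse semigroup admits a faithful representation by partial bijections on some set.
   Context: The ultrafilter lemma (a consequence of the axiom of choice) is assumed. An inverse semigroup is a set $A$ with an associative binary operation $(a,b)\mapsto ab$ such that every $a\in A$ has a unique $a^{-1}\in A$ with $aa^{-1}a=a$ and $a^{-1}aa^{-1}=a^{-1}$. The natural order on $A$ is: $a\leqslant b$ iff $a=be$ for some idempotent $e\in A$. A pair $a,b\in A$ is compatible if both $ab^{-1}$ and $a^{-1}b$ are idempotent. A distributive inverse semigroup is an inverse semigroup $A$ such that: (i) $A$ has a zero element $0$ (with $0a=a0=0$ for all $a$) and a unit $1$; (ii) $A$ has all binary meets with respect to the natural order; (iii) each compatible pair $a,b\in A$ has a join $a\vee b$ in the natural order, and multiplication distributes over these joins on the left and on the right. A homomorphism of distributive inverse semigroups is a semigroup homomorphism preserving the zero, the unit, binary meets and joins of compatible pairs. For a set $X$, $\mathcal{I}(X)$ is the inverse semigroup of partial bijections of $X$ (bijections between subsets of $X$) with multiplication $fg=f\circ g$ (composition as relations); it is a distributive inverse semigroup, with natural order given by inclusion of graphs, meets by intersection of graphs, joins of compatible pairs by union of graphs, zero the empty partial bijection and unit $\mathrm{id}_X$. *)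

theory Defs
  imports "HOL-Algebra.Group"
begin

text \<open>
  Semigroups are carried by the \<^type>\<open>monoid_scheme\<close> record. In \<open>inverse_semigroup\<close> the field
  \<^const>\<open>one\<close> is unconstrained; it becomes a unit only in \<open>distributive_inverse_semigroup\<close>,
  through the locale \<^locale>\<open>monoid\<close>.
\<close>

locale inverse_semigroup =
  fixes A (structure)
  assumes mult_closed: "\<lbrakk>a \<in> carrier A; b \<in> carrier A\<rbrakk> \<Longrightarrow> a \<otimes> b \<in> carrier A"
    and mult_assoc: "\<lbrakk>a \<in> carrier A; b \<in> carrier A; c \<in> carrier A\<rbrakk>
          \<Longrightarrow> (a \<otimes> b) \<otimes> c = a \<otimes> (b \<otimes> c)"
    and ex1_inverse: "a \<in> carrier A \<Longrightarrow> \<exists>!b. b \<in> carrier A \<and> a \<otimes> b \<otimes> a = a \<and> b \<otimes> a \<otimes> b = b"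

text \<open>This is the semigroup inverse; \<^const>\<open>m_inv\<close> is the inverse of a unit.\<close>

definition sg_inv :: "('a, 'b) monoid_scheme \<Rightarrow> 'a \<Rightarrow> 'a"
  where "sg_inv A a =
    (THE b. b \<in> carrier A \<and> a \<otimes>\<^bsub>A\<^esub> b \<otimes>\<^bsub>A\<^esub> a = a \<and> b \<otimes>\<^bsub>A\<^esub> a \<otimes>\<^bsub>A\<^esub> b = b)"

definition idempotents :: "('a, 'b) monoid_scheme \<Rightarrow> 'a set"
  where "idempotents A = {e \<in> carrier A. e \<otimes>\<^bsub>A\<^esub> e = e}"

definition natural_order :: "('a, 'b) monoid_scheme \<Rightarrow> 'a gorder"
  where "natural_order A =
    \<lparr>carrier = carrier A, eq = (=), le = (\<lambda>a b. \<exists>e\<in>idempotents A. a = b \<otimes>\<^bsub>A\<^esub> e)\<rparr>"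

definition compatible :: "('a, 'b) monoid_scheme \<Rightarrow> 'a \<Rightarrow> 'a \<Rightarrow> bool"
  where "compatible A a b \<longleftrightarrow>
    a \<otimes>\<^bsub>A\<^esub> sg_inv A b \<in> idempotents A \<and> sg_inv A a \<otimes>\<^bsub>A\<^esub> b \<in> idempotents A"

definition is_zero :: "('a, 'b) monoid_scheme \<Rightarrow> 'a \<Rightarrow> bool"
  where "is_zero A z \<longleftrightarrow>
    z \<in> carrier A \<and> (\<forall>a\<in>carrier A. z \<otimes>\<^bsub>A\<^esub> a = z \<and> a \<otimes>\<^bsub>A\<^esub> z = z)"

definition sg_zero :: "('a, 'b) monoid_scheme \<Rightarrow> 'a"
  where "sg_zero A = (THE z. is_zero A z)"

abbreviation sg_meet :: "('a, 'b) monoid_scheme \<Rightarrow> 'a \<Rightarrow> 'a \<Rightarrow> 'a"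
  where "sg_meet A a b \<equiv> a \<sqinter>\<^bsub>natural_order A\<^esub> b"

abbreviation sg_join :: "('a, 'b) monoid_scheme \<Rightarrow> 'a \<Rightarrow> 'a \<Rightarrow> 'a"
  where "sg_join A a b \<equiv> a \<squnion>\<^bsub>natural_order A\<^esub> b"

text \<open>
  If \<open>a\<close> and \<open>b\<close> are compatible, then so are \<open>c \<otimes> a\<close> and \<open>c \<otimes> b\<close>, and likewise \<open>a \<otimes> c\<close> and
  \<open>b \<otimes> c\<close>; hence all joins in the distributive laws exist.
\<close>

locale distributive_inverse_semigroup = inverse_semigroup A + monoid A for A (structure) +
  assumes zero_exists: "\<exists>z. is_zero A z"
    and meet_exists: "\<lbrakk>a \<in> carrier A; b \<in> carrier A\<rbrakk>
          \<Longrightarrow> \<exists>m. greatest (natural_order A) m (Lower (natural_order A) {a, b})"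
    and join_exists: "\<lbrakk>a \<in> carrier A; b \<in> carrier A; compatible A a b\<rbrakk>
          \<Longrightarrow> \<exists>j. least (natural_order A) j (Upper (natural_order A) {a, b})"
    and mult_join_left: "\<lbrakk>a \<in> carrier A; b \<in> carrier A; c \<in> carrier A; compatible A a b\<rbrakk>
          \<Longrightarrow> c \<otimes> sg_join A a b = sg_join A (c \<otimes> a) (c \<otimes> b)"
    and mult_join_right: "\<lbrakk>a \<in> carrier A; b \<in> carrier A; c \<in> carrier A; compatible A a b\<rbrakk>
          \<Longrightarrow> sg_join A a b \<otimes> c = sg_join A (a \<otimes> c) (b \<otimes> c)"

locale distributive_inverse_semigroup_hom =
  A?: distributive_inverse_semigroup A + B?: distributive_inverse_semigroup B
  for A (structure) and B (structure) +
  fixes h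
  assumes homh: "h \<in> hom A B"
    and hom_zero: "h (sg_zero A) = sg_zero B"
    and hom_unit: "h \<one>\<^bsub>A\<^esub> = \<one>\<^bsub>B\<^esub>"
    and hom_meet: "\<lbrakk>a \<in> carrier A; b \<in> carrier A\<rbrakk> \<Longrightarrow> h (sg_meet A a b) = sg_meet B (h a) (h b)"
    and hom_join: "\<lbrakk>a \<in> carrier A; b \<in> carrier A; compatible A a b\<rbrakk>
          \<Longrightarrow> h (sg_join A a b) = sg_join B (h a) (h b)"

text \<open>
  A partial bijection is represented by its graph \<open>{(x, f x) | x. x \<in> dom f}\<close>. Since \<^const>\<open>relcomp\<close>
  composes from left to right, the graph of \<open>f \<circ> g\<close> is \<open>g O f\<close>.
\<close>

definition partial_bijections :: "'x set \<Rightarrow> ('x \<times> 'x) set set"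
  where "partial_bijections X = {f. f \<subseteq> X \<times> X \<and> single_valued f \<and> single_valued (f\<inverse>)}"

definition sym_inv_semigroup :: "'x set \<Rightarrow> ('x \<times> 'x) set monoid"
  where "sym_inv_semigroup X =
    \<lparr>carrier = partial_bijections X, mult = (\<lambda>f g. g O f), one = Id_on X\<rparr>"


lemma sym_inv_simps [simp]:
  "carrier (sym_inv_semigroup X) = partial_bijections X"
  "f \<otimes>\<^bsub>sym_inv_semigroup X\<^esub> g = g O f"
  "\<one>\<^bsub>sym_inv_semigroup X\<^esub> = Id_on X"
  by (simp_all add: sym_inv_semigroup_def)

lemma partial_bijections_relcomp:
  "f \<in> partial_bijections X \<Longrightarrow> g \<in> partial_bijections X \<Longrightarrow> g O f \<in> partial_bijections X"
  unfolding partial_bijections_def single_valued_def by blast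

lemma partial_bijections_converse:
  "f \<in> partial_bijections X \<Longrightarrow> f\<inverse> \<in> partial_bijections X"
  unfolding partial_bijections_def single_valued_def by blast

lemma partial_bijections_subset:
  "f \<in> partial_bijections X \<Longrightarrow> g \<subseteq> f \<Longrightarrow> g \<in> partial_bijections X"
  unfolding partial_bijections_def single_valued_def by blast

lemma partial_bijections_Id_on: "Y \<subseteq> X \<Longrightarrow> Id_on Y \<in> partial_bijections X"
  unfolding partial_bijections_def single_valued_def by blast

lemma partial_bijections_unit:
  assumes "f \<in> partial_bijections X"
  shows "f O Id_on X = f" "Id_on X O f = f"
  using assms unfolding partial_bijections_def by blast+

lemma partial_bijections_inverse_iff:
  assumes "f \<in> partial_bijections X"
  shows "g \<in> partial_bijections X \<and> f O g O f = f \<and> g O f O g = g \<longleftrightarrow> g = f\<inverse>"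
proof
  assume g: "g \<in> partial_bijections X \<and> f O g O f = f \<and> g O f O g = g"
  have *: "q\<inverse> \<subseteq> r" if "q O r O q = q" "q \<in> partial_bijections X" for q r
  proof (rule subrelI)
    fix y x assume "(y, x) \<in> q\<inverse>"
    then have xy: "(x, y) \<in> q" by simp
    then have "(x, y) \<in> q O r O q" using that(1) by simp
    then obtain y' x' where "(x, y') \<in> q" "(y', x') \<in> r" "(x', y) \<in> q" by blast
    then show "(y, x) \<in> r"
      using xy that(2) unfolding partial_bijections_def single_valued_def by blast
  qed
  have "f\<inverse> \<subseteq> g" "g\<inverse> \<subseteq> f" using * g assms by blast+
  then show "g = f\<inverse>" by auto
next
  assume "g = f\<inverse>"
  moreover have "f O f\<inverse> O f = f" "f\<inverse> O f O f\<inverse> = f\<inverse>"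
    using assms unfolding partial_bijections_def single_valued_def by blast+
  ultimately show "g \<in> partial_bijections X \<and> f O g O f = f \<and> g O f O g = g"
    using partial_bijections_converse[OF assms] by blast
qed

lemma sym_inv_sg_inv:
  assumes "f \<in> partial_bijections X"
  shows "sg_inv (sym_inv_semigroup X) f = f\<inverse>"
  by (simp add: sg_inv_def partial_bijections_inverse_iff[OF assms])

lemma sym_inv_idempotents:
  "e \<in> idempotents (sym_inv_semigroup X) \<longleftrightarrow> e \<subseteq> Id_on X"
proof
  assume "e \<in> idempotents (sym_inv_semigroup X)"
  then have e: "e \<in> partial_bijections X" "e O e = e" by (simp_all add: idempotents_def)
  show "e \<subseteq> Id_on X"
  proof (rule subrelI)
    fix x y assume xy: "(x, y) \<in> e"
    with e obtain z where "(x, z) \<in> e" "(z, y) \<in> e" by blast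
    with xy e(1) show "(x, y) \<in> Id_on X"
      unfolding partial_bijections_def single_valued_def by blast
  qed
next
  assume *: "e \<subseteq> Id_on X"
  then have "e O e = e" by blast
  with * show "e \<in> idempotents (sym_inv_semigroup X)"
    using partial_bijections_subset[OF partial_bijections_Id_on[OF subset_refl]]
    by (simp add: idempotents_def)
qed

lemma natural_order_simps [simp]:
  "carrier (natural_order A) = carrier A"
  "a .=\<^bsub>natural_order A\<^esub> b \<longleftrightarrow> a = b"
  by (simp_all add: natural_order_def)

lemma natural_order_le:
  "a \<sqsubseteq>\<^bsub>natural_order A\<^esub> b \<longleftrightarrow> (\<exists>e\<in>idempotents A. a = b \<otimes>\<^bsub>A\<^esub> e)"
  by (simp add: natural_order_def)

lemma sym_inv_le:
  assumes "f \<in> partial_bijections X" "g \<in> partial_bijections X"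
  shows "f \<sqsubseteq>\<^bsub>natural_order (sym_inv_semigroup X)\<^esub> g \<longleftrightarrow> f \<subseteq> g"
proof
  assume "f \<sqsubseteq>\<^bsub>natural_order (sym_inv_semigroup X)\<^esub> g"
  then obtain e where "e \<subseteq> Id_on X" "f = e O g" by (auto simp: sym_inv_idempotents natural_order_le)
  then show "f \<subseteq> g" by blast
next
  assume "f \<subseteq> g"
  then have "f = Id_on (Domain f) O g"
    using assms(2) unfolding partial_bijections_def single_valued_def by blast
  moreover have "Id_on (Domain f) \<subseteq> Id_on X"
    using assms unfolding partial_bijections_def by blast
  ultimately show "f \<sqsubseteq>\<^bsub>natural_order (sym_inv_semigroup X)\<^esub> g"
    unfolding natural_order_le sym_inv_simps Bex_def sym_inv_idempotents by blast
qed

lemma sym_inv_compatible_Un: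
  assumes "f \<in> partial_bijections X" "g \<in> partial_bijections X"
  shows "compatible (sym_inv_semigroup X) f g \<longleftrightarrow> f \<union> g \<in> partial_bijections X"
proof -
  have "compatible (sym_inv_semigroup X) f g \<longleftrightarrow> g\<inverse> O f \<subseteq> Id_on X \<and> g O f\<inverse> \<subseteq> Id_on X"
    using assms by (simp add: compatible_def sym_inv_idempotents sym_inv_sg_inv)
  also have "\<dots> \<longleftrightarrow> f \<union> g \<in> partial_bijections X"
  proof
    assume *: "g\<inverse> O f \<subseteq> Id_on X \<and> g O f\<inverse> \<subseteq> Id_on X"
    have "x = y" if "(z, x) \<in> f" "(z, y) \<in> g" for x y z
      using * that by blast
    moreover have "x = y" if "(x, z) \<in> f" "(y, z) \<in> g" for x y z
      using * that by blast
    ultimately show "f \<union> g \<in> partial_bijections X"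
      using assms unfolding partial_bijections_def single_valued_def by simp metis
  next
    assume "f \<union> g \<in> partial_bijections X"
    then show "g\<inverse> O f \<subseteq> Id_on X \<and> g O f\<inverse> \<subseteq> Id_on X"
      unfolding partial_bijections_def single_valued_def by fast
  qed
  finally show ?thesis .
qed

lemma sym_inv_greatest:
  assumes "f \<in> partial_bijections X" "g \<in> partial_bijections X"
  shows "greatest (natural_order (sym_inv_semigroup X)) m
      (Lower (natural_order (sym_inv_semigroup X)) {f, g}) \<longleftrightarrow> m = f \<inter> g"
proof -
  have L: "Lower (natural_order (sym_inv_semigroup X)) {f, g} = {k. k \<subseteq> f \<inter> g}"
  proof (rule Set.set_eqI)
    fix k
    have "k \<in> Lower (natural_order (sym_inv_semigroup X)) {f, g} \<longleftrightarrow>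
        k \<in> partial_bijections X \<and> k \<sqsubseteq>\<^bsub>natural_order (sym_inv_semigroup X)\<^esub> f \<and>
        k \<sqsubseteq>\<^bsub>natural_order (sym_inv_semigroup X)\<^esub> g"
      unfolding Lower_def using assms by auto
    also have "\<dots> \<longleftrightarrow> k \<subseteq> f \<inter> g"
      using assms partial_bijections_subset[OF assms(1), of k] by (auto simp only: sym_inv_le Int_subset_iff)
    finally show "k \<in> Lower (natural_order (sym_inv_semigroup X)) {f, g} \<longleftrightarrow> k \<in> {k. k \<subseteq> f \<inter> g}"
      by simp
  qed
  have P: "k \<in> partial_bijections X" if "k \<subseteq> f \<inter> g" for k
    using assms(1) that partial_bijections_subset by blast
  have "greatest (natural_order (sym_inv_semigroup X)) m {k. k \<subseteq> f \<inter> g} \<longleftrightarrow>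
      m \<subseteq> f \<inter> g \<and> (\<forall>k. k \<subseteq> f \<inter> g \<longrightarrow> k \<sqsubseteq>\<^bsub>natural_order (sym_inv_semigroup X)\<^esub> m)"
    unfolding greatest_def using P by (simp add: subset_iff)
  also have "\<dots> \<longleftrightarrow> m \<subseteq> f \<inter> g \<and> (\<forall>k. k \<subseteq> f \<inter> g \<longrightarrow> k \<subseteq> m)"
    using P sym_inv_le by metis
  also have "\<dots> \<longleftrightarrow> m = f \<inter> g" by (metis subset_antisym subset_refl)
  finally show ?thesis unfolding L .
qed

lemma sym_inv_least:
  assumes "f \<in> partial_bijections X" "g \<in> partial_bijections X"
    and "f \<union> g \<in> partial_bijections X"
  shows "least (natural_order (sym_inv_semigroup X)) j
      (Upper (natural_order (sym_inv_semigroup X)) {f, g}) \<longleftrightarrow> j = f \<union> g"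
proof -
  have U: "Upper (natural_order (sym_inv_semigroup X)) {f, g} =
      {k \<in> partial_bijections X. f \<union> g \<subseteq> k}"
  proof (rule Set.set_eqI)
    fix k
    have "k \<in> Upper (natural_order (sym_inv_semigroup X)) {f, g} \<longleftrightarrow>
        k \<in> partial_bijections X \<and> f \<sqsubseteq>\<^bsub>natural_order (sym_inv_semigroup X)\<^esub> k \<and>
        g \<sqsubseteq>\<^bsub>natural_order (sym_inv_semigroup X)\<^esub> k"
      unfolding Upper_def using assms by auto
    also have "\<dots> \<longleftrightarrow> k \<in> partial_bijections X \<and> f \<union> g \<subseteq> k"
      using assms by (auto simp only: sym_inv_le Un_subset_iff)
    finally show "k \<in> Upper (natural_order (sym_inv_semigroup X)) {f, g} \<longleftrightarrow>
        k \<in> {k \<in> partial_bijections X. f \<union> g \<subseteq> k}"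
      by simp
  qed
  have "least (natural_order (sym_inv_semigroup X)) j {k \<in> partial_bijections X. f \<union> g \<subseteq> k} \<longleftrightarrow>
      j \<in> partial_bijections X \<and> f \<union> g \<subseteq> j \<and> (\<forall>k. k \<in> partial_bijections X \<and> f \<union> g \<subseteq> k \<longrightarrow>
        j \<sqsubseteq>\<^bsub>natural_order (sym_inv_semigroup X)\<^esub> k)"
    unfolding least_def by (simp add: subset_iff)
  also have "\<dots> \<longleftrightarrow> j \<in> partial_bijections X \<and> f \<union> g \<subseteq> j \<and>
      (\<forall>k. k \<in> partial_bijections X \<and> f \<union> g \<subseteq> k \<longrightarrow> j \<subseteq> k)"
    using sym_inv_le by metis
  also have "\<dots> \<longleftrightarrow> j = f \<union> g" by (metis assms(3) subset_antisym subset_refl)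
  finally show ?thesis unfolding U .
qed

lemma sym_inv_meet:
  assumes "f \<in> partial_bijections X" "g \<in> partial_bijections X"
  shows "sg_meet (sym_inv_semigroup X) f g = f \<inter> g"
  by (simp add: meet_def inf_def sym_inv_greatest[OF assms])

lemma sym_inv_join:
  assumes "f \<in> partial_bijections X" "g \<in> partial_bijections X"
    and "f \<union> g \<in> partial_bijections X"
  shows "sg_join (sym_inv_semigroup X) f g = f \<union> g"
  by (simp add: join_def sup_def sym_inv_least[OF assms])

lemma sym_inv_is_zero: "is_zero (sym_inv_semigroup X) z \<longleftrightarrow> z = {}"
proof
  have "{} \<in> partial_bijections X" by (simp add: partial_bijections_def)
  moreover assume "is_zero (sym_inv_semigroup X) z"
  ultimately show "z = {}" by (force simp: is_zero_def)
qed (simp add: is_zero_def partial_bijections_def)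

lemma sym_inv_zero: "sg_zero (sym_inv_semigroup X) = {}"
  by (simp add: sg_zero_def sym_inv_is_zero)

theorem sym_inv_distributive_inverse_semigroup:
  "distributive_inverse_semigroup (sym_inv_semigroup X)"
proof unfold_locales
  fix f assume f: "f \<in> carrier (sym_inv_semigroup X)"
  show "\<exists>!g. g \<in> carrier (sym_inv_semigroup X) \<and>
      f \<otimes>\<^bsub>sym_inv_semigroup X\<^esub> g \<otimes>\<^bsub>sym_inv_semigroup X\<^esub> f = f \<and>
      g \<otimes>\<^bsub>sym_inv_semigroup X\<^esub> f \<otimes>\<^bsub>sym_inv_semigroup X\<^esub> g = g"
    using f by (simp add: partial_bijections_inverse_iff)
next
  fix f g h
  assume *: "f \<in> carrier (sym_inv_semigroup X)" "g \<in> carrier (sym_inv_semigroup X)"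
    "h \<in> carrier (sym_inv_semigroup X)" "compatible (sym_inv_semigroup X) f g"
  then have fg: "f \<union> g \<in> partial_bijections X" by (simp add: sym_inv_compatible_Un)
  have dist: "f O h \<union> g O h = (f \<union> g) O h" "h O f \<union> h O g = h O (f \<union> g)" by (simp_all only: relcomp_distrib relcomp_distrib2)
  have c: "f \<in> partial_bijections X" "g \<in> partial_bijections X" "h \<in> partial_bijections X"
    using * by simp_all
  have "sg_join (sym_inv_semigroup X) (f O h) (g O h) = (f \<union> g) O h"
    unfolding dist(1)[symmetric]
    by (rule sym_inv_join) (simp_all only: dist c fg partial_bijections_relcomp)
  moreover have "sg_join (sym_inv_semigroup X) (h O f) (h O g) = h O (f \<union> g)"
    unfolding dist(2)[symmetric]
    by (rule sym_inv_join) (simp_all only: dist c fg partial_bijections_relcomp)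
  ultimately show "h \<otimes>\<^bsub>sym_inv_semigroup X\<^esub> sg_join (sym_inv_semigroup X) f g =
      sg_join (sym_inv_semigroup X) (h \<otimes>\<^bsub>sym_inv_semigroup X\<^esub> f) (h \<otimes>\<^bsub>sym_inv_semigroup X\<^esub> g)"
    "sg_join (sym_inv_semigroup X) f g \<otimes>\<^bsub>sym_inv_semigroup X\<^esub> h =
      sg_join (sym_inv_semigroup X) (f \<otimes>\<^bsub>sym_inv_semigroup X\<^esub> h) (g \<otimes>\<^bsub>sym_inv_semigroup X\<^esub> h)"
    by (simp_all add: sym_inv_join[OF c(1,2) fg])
qed (auto simp: partial_bijections_relcomp partial_bijections_Id_on
    partial_bijections_unit sym_inv_is_zero sym_inv_greatest sym_inv_least sym_inv_compatible_Un
    O_assoc)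

end

theory Submission
  imports Defs
begin

text \<open>
  Let \<open>A\<close> act on its prime filters by \<open>a \<cdot> F = {y. a\<inverse> y \<in> F}\<close>, the action being defined
  at \<open>F\<close> when this set is nonempty. On its domain this is the upward closure of \<open>aF\<close>, but
  in this form \<open>(ba) \<cdot> F = b \<cdot> (a \<cdot> F)\<close> is immediate, and primality turns joins into unions.
  For faithfulness, if \<open>a \<le> b\<close> fails, then a filter containing \<open>a\<close> and maximal among those
  avoiding \<open>b\<close> is a prime filter \<open>F\<close>, and \<open>a\<close> and \<open>b\<close> act differently on \<open>a\<inverse> \<cdot> F\<close>.
\<close>

section \<open>The natural order of an inverse semigroup\<close>

context inverse_semigroup
begin

abbreviation star :: "'a \<Rightarrow> 'a"  (\<open>_\<^sup>\<star>\<close> [1000] 999)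
  where "a\<^sup>\<star> \<equiv> sg_inv A a"

abbreviation nat_le :: "'a \<Rightarrow> 'a \<Rightarrow> bool"  (infix \<open>\<preceq>\<close> 50)
  where "a \<preceq> b \<equiv> a \<sqsubseteq>\<^bsub>natural_order A\<^esub> b"

declare mult_closed [simp]

section \<open>Calculus of inverses\<close>

lemma star_props:
  assumes "a \<in> carrier A"
  shows "a\<^sup>\<star> \<in> carrier A \<and> a \<otimes> a\<^sup>\<star> \<otimes> a = a \<and> a\<^sup>\<star> \<otimes> a \<otimes> a\<^sup>\<star> = a\<^sup>\<star>"
  unfolding sg_inv_def by (rule theI') (rule ex1_inverse[OF assms])

lemma star_closed [simp]: "a \<in> carrier A \<Longrightarrow> a\<^sup>\<star> \<in> carrier A"
  using star_props by blast

lemma mult_star_mult [simp]: "a \<in> carrier A \<Longrightarrow> a \<otimes> (a\<^sup>\<star> \<otimes> a) = a"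
  using star_props mult_assoc star_closed by metis

lemma star_mult_star [simp]: "a \<in> carrier A \<Longrightarrow> a\<^sup>\<star> \<otimes> (a \<otimes> a\<^sup>\<star>) = a\<^sup>\<star>"
  using star_props mult_assoc star_closed by metis

text \<open>The trailing factor lets rewriting cancel in the middle of products nested to the
  right.\<close>

lemma mult_star_mult2 [simp]:
  "\<lbrakk>a \<in> carrier A; b \<in> carrier A\<rbrakk> \<Longrightarrow> a \<otimes> (a\<^sup>\<star> \<otimes> (a \<otimes> b)) = a \<otimes> b"
  using mult_star_mult mult_assoc star_closed mult_closed by metis

lemma star_mult_star2 [simp]:
  "\<lbrakk>a \<in> carrier A; b \<in> carrier A\<rbrakk> \<Longrightarrow> a\<^sup>\<star> \<otimes> (a \<otimes> (a\<^sup>\<star> \<otimes> b)) = a\<^sup>\<star> \<otimes> b"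
  using star_mult_star mult_assoc star_closed mult_closed by metis

lemma star_unique:
  assumes "a \<in> carrier A" "b \<in> carrier A" "a \<otimes> (b \<otimes> a) = a" "b \<otimes> (a \<otimes> b) = b"
  shows "a\<^sup>\<star> = b"
  using ex1_inverse[OF assms(1)] star_props[OF assms(1)] assms mult_assoc by metis

lemma star_star [simp]: "a \<in> carrier A \<Longrightarrow> (a\<^sup>\<star>)\<^sup>\<star> = a"
  by (rule star_unique) simp_all

section \<open>Idempotents commute\<close>

lemma idempotentsI: "\<lbrakk>e \<in> carrier A; e \<otimes> e = e\<rbrakk> \<Longrightarrow> e \<in> idempotents A"
  by (simp add: idempotents_def)

lemma idem_closed [simp]: "e \<in> idempotents A \<Longrightarrow> e \<in> carrier A"
  by (simp add: idempotents_def)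

lemma idem_idem [simp]: "e \<in> idempotents A \<Longrightarrow> e \<otimes> e = e"
  unfolding idempotents_def by blast

lemma idem_idem2 [simp]:
  "\<lbrakk>e \<in> idempotents A; a \<in> carrier A\<rbrakk> \<Longrightarrow> e \<otimes> (e \<otimes> a) = e \<otimes> a"
  using idem_idem idem_closed mult_assoc by metis

lemma idem_star [simp]: "e \<in> idempotents A \<Longrightarrow> e\<^sup>\<star> = e"
  by (rule star_unique) simp_all

text \<open>With \<open>x\<close> the inverse of \<open>e \<otimes> f\<close>, the element
  \<open>f \<otimes> (x \<otimes> e)\<close> is an inverse of \<open>e \<otimes> f\<close> as well,
  so uniqueness gives \<open>x = f \<otimes> (x \<otimes> e)\<close>. This form makes
  \<open>x\<close> idempotent. An idempotent is its own inverse, so \<open>e \<otimes> f\<close>,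
  the inverse of \<open>x\<close>, is idempotent too.\<close>

lemma idem_mult_closed:
  assumes e: "e \<in> idempotents A" and f: "f \<in> idempotents A"
  shows "e \<otimes> f \<in> idempotents A"
proof -
  have [simp]: "e \<in> carrier A" "f \<in> carrier A" using e f by simp_all
  define x where "x = (e \<otimes> f)\<^sup>\<star>"
  have [simp]: "x \<in> carrier A" by (simp add: x_def)
  have "e \<otimes> f \<otimes> (x \<otimes> (e \<otimes> f)) = e \<otimes> f" "x \<otimes> (e \<otimes> f \<otimes> x) = x"
    by (simp_all add: x_def)
  then have efx: "e \<otimes> (f \<otimes> (x \<otimes> (e \<otimes> f))) = e \<otimes> f"
    and xef: "x \<otimes> (e \<otimes> (f \<otimes> x)) = x"
    by (simp_all add: mult_assoc)
  have fxe: "x = f \<otimes> (x \<otimes> e)"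
    unfolding x_def
  proof (rule star_unique, fold x_def)
    have "f \<otimes> (x \<otimes> e) \<otimes> (e \<otimes> f \<otimes> (f \<otimes> (x \<otimes> e))) = f \<otimes> ((x \<otimes> (e \<otimes> (f \<otimes> x))) \<otimes> e)"
      using e f by (simp add: mult_assoc)
    then show "f \<otimes> (x \<otimes> e) \<otimes> (e \<otimes> f \<otimes> (f \<otimes> (x \<otimes> e))) = f \<otimes> (x \<otimes> e)"
      by (simp only: xef)
  qed (use e f in \<open>simp_all add: mult_assoc efx\<close>)
  have "x \<otimes> x = (f \<otimes> (x \<otimes> e)) \<otimes> (f \<otimes> (x \<otimes> e))"
    using fxe by (rule arg_cong)
  also have "\<dots> = f \<otimes> ((x \<otimes> (e \<otimes> (f \<otimes> x))) \<otimes> e)"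
    by (simp add: mult_assoc)
  also have "\<dots> = x"
    by (simp only: xef flip: fxe)
  finally have "x \<in> idempotents A"
    by (rule idempotentsI[rotated]) simp_all
  then have "x\<^sup>\<star> \<in> idempotents A" by simp
  then show ?thesis by (simp add: x_def)
qed

text \<open>Both products are idempotent, so \<open>f \<otimes> e\<close> is an inverse of
  \<open>e \<otimes> f\<close>, while \<open>e \<otimes> f\<close> is its own inverse. Uniqueness of
  inverses identifies the two.\<close>

lemma idem_commute:
  assumes e: "e \<in> idempotents A" and f: "f \<in> idempotents A"
  shows "e \<otimes> f = f \<otimes> e"
proof -
  have ef: "e \<otimes> (f \<otimes> (e \<otimes> f)) = e \<otimes> f" and fe: "f \<otimes> (e \<otimes> (f \<otimes> e)) = f \<otimes> e"
    using idem_idem[OF idem_mult_closed[OF e f]] idem_idem[OF idem_mult_closed[OF f e]] e f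
    by (simp_all add: mult_assoc)
  have "(e \<otimes> f)\<^sup>\<star> = f \<otimes> e"
    using e f by (intro star_unique) (simp_all add: mult_assoc ef fe)
  moreover have "(e \<otimes> f)\<^sup>\<star> = e \<otimes> f"
    by (rule idem_star[OF idem_mult_closed[OF e f]])
  ultimately show ?thesis by simp
qed

lemma idem_left_commute:
  "\<lbrakk>e \<in> idempotents A; f \<in> idempotents A; a \<in> carrier A\<rbrakk> \<Longrightarrow> e \<otimes> (f \<otimes> a) = f \<otimes> (e \<otimes> a)"
  by (simp add: idem_commute[of e f] flip: mult_assoc)

lemma mult_star_idem [simp]: "a \<in> carrier A \<Longrightarrow> a \<otimes> a\<^sup>\<star> \<in> idempotents A"
  by (rule idempotentsI) (simp_all add: mult_assoc)

lemma star_mult_idem [simp]: "a \<in> carrier A \<Longrightarrow> a\<^sup>\<star> \<otimes> a \<in> idempotents A"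
  by (rule idempotentsI) (simp_all add: mult_assoc)

text \<open>The idempotents \<open>b \<otimes> b\<^sup>\<star>\<close> and
  \<open>a\<^sup>\<star> \<otimes> a\<close> meet in the middle of the product. Once they are
  swapped, each is absorbed by its neighbour.\<close>

lemma star_mult:
  assumes [simp]: "a \<in> carrier A" "b \<in> carrier A"
  shows "(a \<otimes> b)\<^sup>\<star> = b\<^sup>\<star> \<otimes> a\<^sup>\<star>"
proof (rule star_unique)
  have "a \<otimes> b \<otimes> (b\<^sup>\<star> \<otimes> a\<^sup>\<star> \<otimes> (a \<otimes> b)) = a \<otimes> ((b \<otimes> b\<^sup>\<star>) \<otimes> ((a\<^sup>\<star> \<otimes> a) \<otimes> b))"
    by (simp add: mult_assoc)
  also have "\<dots> = a \<otimes> ((a\<^sup>\<star> \<otimes> a) \<otimes> ((b \<otimes> b\<^sup>\<star>) \<otimes> b))"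
    using idem_left_commute[of "b \<otimes> b\<^sup>\<star>" "a\<^sup>\<star> \<otimes> a" b] by simp
  also have "\<dots> = a \<otimes> b" by (simp add: mult_assoc)
  finally show "a \<otimes> b \<otimes> (b\<^sup>\<star> \<otimes> a\<^sup>\<star> \<otimes> (a \<otimes> b)) = a \<otimes> b" .
  have "b\<^sup>\<star> \<otimes> a\<^sup>\<star> \<otimes> (a \<otimes> b \<otimes> (b\<^sup>\<star> \<otimes> a\<^sup>\<star>)) = b\<^sup>\<star> \<otimes> ((a\<^sup>\<star> \<otimes> a) \<otimes> ((b \<otimes> b\<^sup>\<star>) \<otimes> a\<^sup>\<star>))"
    by (simp add: mult_assoc)
  also have "\<dots> = b\<^sup>\<star> \<otimes> ((b \<otimes> b\<^sup>\<star>) \<otimes> ((a\<^sup>\<star> \<otimes> a) \<otimes> a\<^sup>\<star>))"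
    using idem_left_commute[of "a\<^sup>\<star> \<otimes> a" "b \<otimes> b\<^sup>\<star>" "a\<^sup>\<star>"] by simp
  also have "\<dots> = b\<^sup>\<star> \<otimes> a\<^sup>\<star>" by (simp add: mult_assoc)
  finally show "b\<^sup>\<star> \<otimes> a\<^sup>\<star> \<otimes> (a \<otimes> b \<otimes> (b\<^sup>\<star> \<otimes> a\<^sup>\<star>)) = b\<^sup>\<star> \<otimes> a\<^sup>\<star>" .
qed simp_all

lemma conj_idem:
  assumes a [simp]: "a \<in> carrier A" and e: "e \<in> idempotents A"
  shows "a \<otimes> (e \<otimes> a\<^sup>\<star>) \<in> idempotents A"
proof -
  have [simp]: "e \<in> carrier A" using e by simp
  have "a \<otimes> (e \<otimes> a\<^sup>\<star>) \<otimes> (a \<otimes> (e \<otimes> a\<^sup>\<star>)) = a \<otimes> (e \<otimes> ((a\<^sup>\<star> \<otimes> a) \<otimes> (e \<otimes> a\<^sup>\<star>)))"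
    by (simp add: mult_assoc)
  also have "\<dots> = a \<otimes> ((a\<^sup>\<star> \<otimes> a) \<otimes> (e \<otimes> (e \<otimes> a\<^sup>\<star>)))"
    using idem_left_commute[OF e, of "a\<^sup>\<star> \<otimes> a" "e \<otimes> a\<^sup>\<star>"] by simp
  also have "\<dots> = a \<otimes> (e \<otimes> a\<^sup>\<star>)"
    using e by (simp add: mult_assoc)
  finally show ?thesis by (rule idempotentsI[rotated]) simp_all
qed

lemma conj_idem':
  "\<lbrakk>a \<in> carrier A; e \<in> idempotents A\<rbrakk> \<Longrightarrow> a\<^sup>\<star> \<otimes> (e \<otimes> a) \<in> idempotents A"
  using conj_idem[of "a\<^sup>\<star>" e] by simp

section \<open>The natural order and its compatibility with the operations\<close>

lemma le_right_mult:
  "\<lbrakk>b \<in> carrier A; e \<in> idempotents A\<rbrakk> \<Longrightarrow> b \<otimes> e \<preceq> b"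
  by (auto simp: natural_order_le)

text \<open>An idempotent on the left moves to the right as its conjugate
  \<open>b\<^sup>\<star> \<otimes> (e \<otimes> b)\<close>. Together with \<open>leE_left\<close>
  this makes the order, defined by right multiples, symmetric in the two sides.\<close>

lemma le_left_mult:
  assumes b [simp]: "b \<in> carrier A" and e: "e \<in> idempotents A"
  shows "e \<otimes> b \<preceq> b"
proof -
  have "e \<otimes> b = e \<otimes> ((b \<otimes> b\<^sup>\<star>) \<otimes> b)" by (simp add: mult_assoc)
  also have "\<dots> = b \<otimes> (b\<^sup>\<star> \<otimes> (e \<otimes> b))"
    using idem_left_commute[OF e, of "b \<otimes> b\<^sup>\<star>" b] e by (simp add: mult_assoc)
  finally show ?thesis
    using conj_idem'[OF b e] by (auto simp: natural_order_le)
qed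

lemma leE:
  assumes "a \<preceq> b"
  obtains e where "e \<in> idempotents A" "a = b \<otimes> e"
  using assms by (auto simp: natural_order_le)

lemma leE_left:
  assumes "a \<preceq> b" and b [simp]: "b \<in> carrier A"
  obtains e where "e \<in> idempotents A" "a = e \<otimes> b"
proof -
  obtain e where e: "e \<in> idempotents A" and a: "a = b \<otimes> e" using assms leE by blast
  have "b \<otimes> e = b \<otimes> ((b\<^sup>\<star> \<otimes> b) \<otimes> e)" using e by (simp add: mult_assoc)
  also have "\<dots> = (b \<otimes> (e \<otimes> b\<^sup>\<star>)) \<otimes> b"
    using idem_commute[OF e, of "b\<^sup>\<star> \<otimes> b"] e by (simp add: mult_assoc)
  finally show ?thesis
    using conj_idem[OF b e] a that by blast
qed

text \<open>The idempotent witnessing the order has a canonical choice: if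
  \<open>a = b \<otimes> e\<close>, then \<open>a\<^sup>\<star> \<otimes> a\<close> is
  \<open>e\<close> times \<open>b\<^sup>\<star> \<otimes> b\<close> times \<open>e\<close>, and
  \<open>b\<close> absorbs its own \<open>b\<^sup>\<star> \<otimes> b\<close>.\<close>

lemma le_imp_eq:
  assumes "a \<preceq> b" and b [simp]: "b \<in> carrier A"
  shows "a = b \<otimes> (a\<^sup>\<star> \<otimes> a)"
proof -
  obtain e where e: "e \<in> idempotents A" and a: "a = b \<otimes> e" using assms leE by blast
  have "b \<otimes> (a\<^sup>\<star> \<otimes> a) = b \<otimes> (e \<otimes> ((b\<^sup>\<star> \<otimes> b) \<otimes> e))"
    using e by (simp add: a star_mult mult_assoc)
  also have "\<dots> = b \<otimes> e"
    using idem_left_commute[OF e, of "b\<^sup>\<star> \<otimes> b" e] e by (simp add: mult_assoc)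
  finally show ?thesis using a by simp
qed

lemma le_refl [simp]: "a \<in> carrier A \<Longrightarrow> a \<preceq> a"
  using le_right_mult[of a "a\<^sup>\<star> \<otimes> a"] by simp

lemma le_trans:
  assumes "a \<preceq> b" "b \<preceq> c" and c: "c \<in> carrier A"
  shows "a \<preceq> c"
proof -
  obtain e f where "e \<in> idempotents A" "a = b \<otimes> e" "f \<in> idempotents A" "b = c \<otimes> f"
    using assms leE by metis
  then show ?thesis
    using c le_right_mult[OF c idem_mult_closed[of f e]] by (simp add: mult_assoc)
qed

lemma le_antisym:
  assumes "a \<preceq> b" "b \<preceq> a" and [simp]: "a \<in> carrier A" "b \<in> carrier A"
  shows "a = b"
proof -
  have a: "a = b \<otimes> (a\<^sup>\<star> \<otimes> a)" and b: "b = a \<otimes> (b\<^sup>\<star> \<otimes> b)"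
    using assms le_imp_eq by blast+
  have "a = b \<otimes> (a\<^sup>\<star> \<otimes> a)" by (rule a)
  also have "\<dots> = a \<otimes> (b\<^sup>\<star> \<otimes> b) \<otimes> (a\<^sup>\<star> \<otimes> a)" using b by (rule arg_cong)
  also have "\<dots> = a \<otimes> ((b\<^sup>\<star> \<otimes> b) \<otimes> (a\<^sup>\<star> \<otimes> a))" by (simp add: mult_assoc)
  also have "\<dots> = a \<otimes> ((a\<^sup>\<star> \<otimes> a) \<otimes> (b\<^sup>\<star> \<otimes> b))"
    using idem_commute[of "b\<^sup>\<star> \<otimes> b" "a\<^sup>\<star> \<otimes> a"] by simp
  also have "\<dots> = a \<otimes> (b\<^sup>\<star> \<otimes> b)" by (simp flip: mult_assoc) (simp add: mult_assoc)
  also have "\<dots> = b" by (rule b[symmetric])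
  finally show ?thesis .
qed

lemma mult_left_mono:
  assumes "a \<preceq> b" and "b \<in> carrier A" "c \<in> carrier A"
  shows "c \<otimes> a \<preceq> c \<otimes> b"
proof -
  obtain e where e: "e \<in> idempotents A" "a = b \<otimes> e" using assms leE by blast
  then show ?thesis
    using assms le_right_mult[of "c \<otimes> b" e] by (simp add: mult_assoc)
qed

lemma mult_right_mono:
  assumes "a \<preceq> b" and "b \<in> carrier A" "c \<in> carrier A"
  shows "a \<otimes> c \<preceq> b \<otimes> c"
proof -
  obtain e where e: "e \<in> idempotents A" "a = e \<otimes> b" using assms leE_left by blast
  then show ?thesis
    using assms le_left_mult[of "b \<otimes> c" e] by (simp add: mult_assoc)
qed

lemma star_mono:
  assumes "a \<preceq> b" and b: "b \<in> carrier A"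
  shows "a\<^sup>\<star> \<preceq> b\<^sup>\<star>"
proof -
  obtain e where e: "e \<in> idempotents A" "a = b \<otimes> e" using assms leE by blast
  then show ?thesis
    using b le_left_mult[of "b\<^sup>\<star>" e] by (simp add: star_mult)
qed

lemma star_le_iff:
  "\<lbrakk>a \<in> carrier A; b \<in> carrier A\<rbrakk> \<Longrightarrow> a\<^sup>\<star> \<preceq> b \<longleftrightarrow> a \<preceq> b\<^sup>\<star>"
  using star_mono star_star star_closed by metis

lemma le_idem:
  assumes "a \<preceq> e" "e \<in> idempotents A"
  shows "a \<in> idempotents A"
  using assms by (auto elim!: leE intro: idem_mult_closed)

lemma star_mult_mult_le: "\<lbrakk>a \<in> carrier A; y \<in> carrier A\<rbrakk> \<Longrightarrow> a\<^sup>\<star> \<otimes> (a \<otimes> y) \<preceq> y"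
  using le_left_mult[of y "a\<^sup>\<star> \<otimes> a"] by (simp add: mult_assoc)

lemma mult_star_mult_le: "\<lbrakk>a \<in> carrier A; y \<in> carrier A\<rbrakk> \<Longrightarrow> a \<otimes> (a\<^sup>\<star> \<otimes> y) \<preceq> y"
  using star_mult_mult_le[of "a\<^sup>\<star>" y] by simp

text \<open>As \<open>w\<close> is a right multiple of \<open>a\<^sup>\<star> \<otimes> y\<close>,
  it is fixed by \<open>a\<^sup>\<star> \<otimes> a\<close>. This is what places
  \<open>a \<otimes> w\<close> in \<open>filter_act A a F\<close> once \<open>w\<close> is in
  \<open>F\<close>.\<close>

lemma le_star_mult_absorb:
  assumes "w \<preceq> a\<^sup>\<star> \<otimes> y" "a \<in> carrier A" "y \<in> carrier A"
  shows "a\<^sup>\<star> \<otimes> (a \<otimes> w) = w"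
  using assms by (auto elim!: leE simp: mult_assoc)

section \<open>Compatible pairs under inversion and multiplication\<close>

lemma compatible_star:
  "\<lbrakk>a \<in> carrier A; b \<in> carrier A; compatible A a b\<rbrakk> \<Longrightarrow> compatible A (a\<^sup>\<star>) (b\<^sup>\<star>)"
  by (simp add: compatible_def)

text \<open>One of the two products is the conjugate of \<open>a \<otimes> b\<^sup>\<star>\<close>
  by \<open>c\<close>. The other lies below \<open>a\<^sup>\<star> \<otimes> b\<close>, and
  everything below an idempotent is idempotent.\<close>

lemma compatible_mult_left:
  assumes [simp]: "a \<in> carrier A" "b \<in> carrier A" "c \<in> carrier A" and "compatible A a b"
  shows "compatible A (c \<otimes> a) (c \<otimes> b)"
proof -
  have i: "a \<otimes> b\<^sup>\<star> \<in> idempotents A" "a\<^sup>\<star> \<otimes> b \<in> idempotents A"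
    using assms by (simp_all add: compatible_def)
  have "a\<^sup>\<star> \<otimes> (c\<^sup>\<star> \<otimes> (c \<otimes> b)) \<preceq> a\<^sup>\<star> \<otimes> b"
    by (intro mult_left_mono star_mult_mult_le) simp_all
  then show ?thesis
    using conj_idem[OF assms(3) i(1)] le_idem[OF _ i(2)]
    by (simp add: compatible_def star_mult mult_assoc)
qed

lemma compatible_mult_right:
  assumes [simp]: "a \<in> carrier A" "b \<in> carrier A" "c \<in> carrier A" and "compatible A a b"
  shows "compatible A (a \<otimes> c) (b \<otimes> c)"
proof -
  have "compatible A ((c\<^sup>\<star> \<otimes> a\<^sup>\<star>)\<^sup>\<star>) ((c\<^sup>\<star> \<otimes> b\<^sup>\<star>)\<^sup>\<star>)"
    using assms by (intro compatible_star compatible_mult_left) simp_all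
  then show ?thesis by (simp add: star_mult)
qed

end

section \<open>Prime filters\<close>

text \<open>Downward directedness stands in for closure under meets, which need not exist in a bare
  inverse semigroup. The zero is allowed here and excluded only in
  \<open>prime_filter\<close>.\<close>

definition sg_filter :: "('a, 'b) monoid_scheme \<Rightarrow> 'a set \<Rightarrow> bool"
  where "sg_filter A F \<longleftrightarrow> F \<subseteq> carrier A \<and> F \<noteq> {} \<and>
    (\<forall>x\<in>F. \<forall>y\<in>carrier A. x \<sqsubseteq>\<^bsub>natural_order A\<^esub> y \<longrightarrow> y \<in> F) \<and>
    (\<forall>x\<in>F. \<forall>y\<in>F. \<exists>w\<in>F. w \<sqsubseteq>\<^bsub>natural_order A\<^esub> x \<and> w \<sqsubseteq>\<^bsub>natural_order A\<^esub> y)"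

definition prime_filter :: "('a, 'b) monoid_scheme \<Rightarrow> 'a set \<Rightarrow> bool"
  where "prime_filter A F \<longleftrightarrow> sg_filter A F \<and> sg_zero A \<notin> F \<and>
    (\<forall>x\<in>carrier A. \<forall>y\<in>carrier A. compatible A x y \<longrightarrow> sg_join A x y \<in> F \<longrightarrow> x \<in> F \<or> y \<in> F)"

definition filter_act :: "('a, 'b) monoid_scheme \<Rightarrow> 'a \<Rightarrow> 'a set \<Rightarrow> 'a set"
  where "filter_act A a F = {y \<in> carrier A. sg_inv A a \<otimes>\<^bsub>A\<^esub> y \<in> F}"

definition filter_rep :: "('a, 'b) monoid_scheme \<Rightarrow> 'a \<Rightarrow> ('a set \<times> 'a set) set"
  where "filter_rep A a =
    {(F, G). prime_filter A F \<and> G = filter_act A a F \<and> G \<noteq> {}}"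

lemma sg_filter_carrier: "sg_filter A F \<Longrightarrow> x \<in> F \<Longrightarrow> x \<in> carrier A"
  by (auto simp: sg_filter_def)

lemma sg_filter_up:
  "\<lbrakk>sg_filter A F; x \<in> F; x \<sqsubseteq>\<^bsub>natural_order A\<^esub> y; y \<in> carrier A\<rbrakk> \<Longrightarrow> y \<in> F"
  by (auto simp: sg_filter_def)

lemma sg_filter_directedE:
  assumes "sg_filter A F" "x \<in> F" "y \<in> F"
  obtains w where "w \<in> F" "w \<in> carrier A"
    "w \<sqsubseteq>\<^bsub>natural_order A\<^esub> x" "w \<sqsubseteq>\<^bsub>natural_order A\<^esub> y"
  using assms unfolding sg_filter_def by blast

lemma prime_filter_sg_filter: "prime_filter A F \<Longrightarrow> sg_filter A F"
  by (simp add: prime_filter_def)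

text \<open>The upper bound for Zorn's lemma: two elements of the union already lie in one member of
  the chain, where a lower bound exists.\<close>

lemma sg_filter_Union_chain:
  assumes C: "subset.chain (Collect (sg_filter A)) C" and "C \<noteq> {}"
  shows "sg_filter A (\<Union>C)"
  unfolding sg_filter_def
proof (intro conjI ballI impI)
  have sub: "C \<subseteq> Collect (sg_filter A)" and lin: "\<forall>F\<in>C. \<forall>G\<in>C. F \<subseteq> G \<or> G \<subseteq> F"
    using C unfolding subset_chain_def by simp_all
  have F: "sg_filter A F" if "F \<in> C" for F
    using sub that by auto
  show "\<Union>C \<subseteq> carrier A"
    using F sg_filter_carrier by fast
  have "F \<noteq> {}" if "F \<in> C" for F
    using F[OF that] by (simp add: sg_filter_def)
  then show "\<Union>C \<noteq> {}"
    using \<open>C \<noteq> {}\<close> by simp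
  show "y \<in> \<Union>C" if "x \<in> \<Union>C" "y \<in> carrier A" "x \<sqsubseteq>\<^bsub>natural_order A\<^esub> y" for x y
  proof -
    from that(1) obtain G where "G \<in> C" "x \<in> G" by blast
    then show ?thesis using sg_filter_up[OF F _ that(3,2)] by (intro UnionI)
  qed
  fix x y assume "x \<in> \<Union>C" "y \<in> \<Union>C"
  then obtain G K where GK: "G \<in> C" "x \<in> G" "K \<in> C" "y \<in> K"
    by (elim UnionE)
  have "G \<subseteq> K \<or> K \<subseteq> G" using lin GK by simp
  then obtain H where H: "H \<in> C" "x \<in> H" "y \<in> H"
    using GK by (elim disjE) (simp_all add: subset_iff)
  then obtain w where "w \<in> H" "w \<sqsubseteq>\<^bsub>natural_order A\<^esub> x" "w \<sqsubseteq>\<^bsub>natural_order A\<^esub> y"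
    using sg_filter_directedE[OF F] by metis
  then show "\<exists>w\<in>\<Union>C. w \<sqsubseteq>\<^bsub>natural_order A\<^esub> x \<and> w \<sqsubseteq>\<^bsub>natural_order A\<^esub> y"
    using H(1) by (intro bexI[of _ w] conjI UnionI)
qed

section \<open>The action on filters\<close>

context inverse_semigroup
begin

lemma principal_filter:
  assumes "a \<in> carrier A"
  shows "sg_filter A {y \<in> carrier A. a \<preceq> y}"
  using assms by (auto simp: sg_filter_def intro: le_trans)

lemma filter_act_mult:
  assumes "a \<in> carrier A" "b \<in> carrier A"
  shows "filter_act A (b \<otimes> a) F = filter_act A b (filter_act A a F)"
  using assms by (auto simp: filter_act_def star_mult mult_assoc)

lemma sg_filter_act:
  assumes F: "sg_filter A F" and a [simp]: "a \<in> carrier A" and ne: "filter_act A a F \<noteq> {}"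
  shows "sg_filter A (filter_act A a F)"
  unfolding sg_filter_def
proof (intro conjI ballI impI)
  show "filter_act A a F \<subseteq> carrier A" by (auto simp: filter_act_def)
  show "y \<in> filter_act A a F"
    if "x \<in> filter_act A a F" "y \<in> carrier A" "x \<preceq> y" for x y
    using that mult_left_mono[of x y "a\<^sup>\<star>"] sg_filter_up[OF F, of "a\<^sup>\<star> \<otimes> x" "a\<^sup>\<star> \<otimes> y"]
    by (simp add: filter_act_def)
  fix x y assume *: "x \<in> filter_act A a F" "y \<in> filter_act A a F"
  then have xy: "x \<in> carrier A" "y \<in> carrier A" by (simp_all add: filter_act_def)
  have "a\<^sup>\<star> \<otimes> x \<in> F" "a\<^sup>\<star> \<otimes> y \<in> F"
    using * by (simp_all add: filter_act_def)
  then obtain w where w: "w \<in> F" "w \<in> carrier A" "w \<preceq> a\<^sup>\<star> \<otimes> x" "w \<preceq> a\<^sup>\<star> \<otimes> y"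
    by (rule sg_filter_directedE[OF F])
  \<comment> \<open>The lower bound \<open>w\<close> found in \<open>F\<close> is pushed forward to
    \<open>a \<otimes> w\<close>, which is the lower bound wanted in the image.\<close>
  have "a\<^sup>\<star> \<otimes> (a \<otimes> w) = w"
    by (rule le_star_mult_absorb[OF w(3)]) (simp_all add: xy)
  then have "a \<otimes> w \<in> filter_act A a F" using w by (simp add: filter_act_def)
  moreover have "a \<otimes> w \<preceq> z" if "w \<preceq> a\<^sup>\<star> \<otimes> z" "z \<in> carrier A" for z
    by (rule le_trans[OF mult_left_mono[OF that(1)] mult_star_mult_le]) (simp_all add: that)
  ultimately show "\<exists>w\<in>filter_act A a F. w \<preceq> x \<and> w \<preceq> y"
    using w(3,4) xy by blast
qed (rule ne)

text \<open>Where the action is defined, every member of \<open>F\<close> has some \<open>w\<close>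
  in \<open>F\<close> below it with \<open>a\<^sup>\<star> \<otimes> (a \<otimes> w) = w\<close>.
  Whether such a \<open>w\<close> belongs to a filter can be read off from
  \<open>a \<otimes> w\<close> in the image. Symmetry gives the other inclusion.\<close>

lemma filter_act_inj:
  assumes F: "sg_filter A F" and G: "sg_filter A G" and a [simp]: "a \<in> carrier A"
    and eq: "filter_act A a F = filter_act A a G" and ne: "filter_act A a F \<noteq> {}"
  shows "F \<subseteq> G"
proof
  fix x assume x: "x \<in> F"
  obtain y where y: "a\<^sup>\<star> \<otimes> y \<in> F" "y \<in> carrier A" using ne by (auto simp: filter_act_def)
  obtain w where w: "w \<in> F" "w \<in> carrier A" "w \<preceq> x" "w \<preceq> a\<^sup>\<star> \<otimes> y"
    using sg_filter_directedE[OF F x y(1)] .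
  have *: "a\<^sup>\<star> \<otimes> (a \<otimes> w) = w"
    by (rule le_star_mult_absorb[OF w(4)]) (simp_all add: y)
  then have "a \<otimes> w \<in> filter_act A a F"
    using w by (simp add: filter_act_def)
  then have "a \<otimes> w \<in> filter_act A a G" by (simp only: eq)
  then have "w \<in> G" by (simp add: filter_act_def *)
  then show "x \<in> G" using sg_filter_up[OF G _ w(3)] sg_filter_carrier[OF F x] by blast
qed

text \<open>Enlarging \<open>a\<close> to \<open>b\<close> extends the partial map without changing
  its values where \<open>a\<close> is already defined.\<close>

lemma filter_act_mono:
  assumes F: "sg_filter A F" and ab: "a \<preceq> b" and [simp]: "a \<in> carrier A" "b \<in> carrier A"
    and ne: "filter_act A a F \<noteq> {}"
  shows "filter_act A a F = filter_act A b F"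
proof (rule Set.set_eqI)
  fix y
  obtain z where z: "a\<^sup>\<star> \<otimes> z \<in> F" "z \<in> carrier A" using ne by (auto simp: filter_act_def)
  have "b\<^sup>\<star> \<otimes> y \<in> F" if "a\<^sup>\<star> \<otimes> y \<in> F" "y \<in> carrier A"
    using that ab by (intro sg_filter_up[OF F that(1)] mult_right_mono star_mono) simp_all
  moreover have "a\<^sup>\<star> \<otimes> y \<in> F" if y: "b\<^sup>\<star> \<otimes> y \<in> F" "y \<in> carrier A"
  proof -
    obtain w where w: "w \<in> F" "w \<in> carrier A" "w \<preceq> a\<^sup>\<star> \<otimes> z" "w \<preceq> b\<^sup>\<star> \<otimes> y"
      using sg_filter_directedE[OF F z(1) y(1)] .
    have *: "a\<^sup>\<star> \<otimes> (a \<otimes> w) = w"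
      by (rule le_star_mult_absorb[OF w(3)]) (simp_all add: z)
    \<comment> \<open>As \<open>a\<close> is a restriction of \<open>b\<close>, its inverse factors
      through that of \<open>b\<close>; this turns a bound on
      \<open>b\<^sup>\<star> \<otimes> y\<close> into one on
      \<open>a\<^sup>\<star> \<otimes> y\<close>.\<close>
    have "a\<^sup>\<star> = (b \<otimes> (a\<^sup>\<star> \<otimes> a))\<^sup>\<star>" using le_imp_eq[OF ab] by simp
    then have a: "a\<^sup>\<star> = a\<^sup>\<star> \<otimes> (a \<otimes> b\<^sup>\<star>)" by (simp add: star_mult mult_assoc)
    have "a\<^sup>\<star> \<otimes> (a \<otimes> w) \<preceq> a\<^sup>\<star> \<otimes> (a \<otimes> (b\<^sup>\<star> \<otimes> y))"
      using w y by (intro mult_left_mono) simp_all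
    also have "a\<^sup>\<star> \<otimes> (a \<otimes> (b\<^sup>\<star> \<otimes> y)) = a\<^sup>\<star> \<otimes> y"
      using arg_cong[OF a, of "\<lambda>u. u \<otimes> y"] y by (simp add: mult_assoc)
    finally show ?thesis
      using y w * sg_filter_up[OF F w(1)] by simp
  qed
  ultimately show "y \<in> filter_act A a F \<longleftrightarrow> y \<in> filter_act A b F"
    by (auto simp: filter_act_def)
qed

text \<open>
  Any \<open>w \<in> F\<close> below both \<open>a\<^sup>\<star> y\<close> and \<open>b\<^sup>\<star> y\<close> satisfies \<open>aw = bw = y w\<^sup>\<star> w\<close>, so
  \<open>a\<close> and \<open>b\<close> agree on \<open>w w\<^sup>\<star>\<close> and this restriction is the common lower bound sought.
\<close>

lemma filter_act_common_lower:
  assumes F: "sg_filter A F" and [simp]: "a \<in> carrier A" "b \<in> carrier A"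
    and y: "y \<in> filter_act A a F" "y \<in> filter_act A b F"
  obtains c where "c \<in> carrier A" "c \<preceq> a" "c \<preceq> b" "y \<in> filter_act A c F"
proof -
  have [simp]: "y \<in> carrier A" and ay: "a\<^sup>\<star> \<otimes> y \<in> F" and "by": "b\<^sup>\<star> \<otimes> y \<in> F"
    using y by (simp_all add: filter_act_def)
  obtain w where w: "w \<in> F" and [simp]: "w \<in> carrier A"
    and wa: "w \<preceq> a\<^sup>\<star> \<otimes> y" and wb: "w \<preceq> b\<^sup>\<star> \<otimes> y"
    using sg_filter_directedE[OF F ay "by"] .
  have eq: "d \<otimes> w = y \<otimes> (w\<^sup>\<star> \<otimes> w)" if "w \<preceq> d\<^sup>\<star> \<otimes> y" and [simp]: "d \<in> carrier A" for d
  proof -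
    have *: "d\<^sup>\<star> \<otimes> (d \<otimes> w) = w" by (rule le_star_mult_absorb[OF that(1)]) simp_all
    have "d \<otimes> w \<preceq> y"
      by (rule le_trans[OF mult_left_mono[OF that(1)] mult_star_mult_le]) simp_all
    then have "d \<otimes> w = y \<otimes> ((d \<otimes> w)\<^sup>\<star> \<otimes> (d \<otimes> w))" by (intro le_imp_eq) simp_all
    then show ?thesis by (simp add: star_mult mult_assoc *)
  qed
  define c where "c = a \<otimes> (w \<otimes> w\<^sup>\<star>)"
  have "a \<otimes> w \<otimes> w\<^sup>\<star> = b \<otimes> w \<otimes> w\<^sup>\<star>" using eq[OF wa] eq[OF wb] by simp
  then have cb: "c = b \<otimes> (w \<otimes> w\<^sup>\<star>)" by (simp add: c_def mult_assoc)
  have [simp]: "c \<in> carrier A" by (simp add: c_def)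
  have "c\<^sup>\<star> \<otimes> y = w \<otimes> (w\<^sup>\<star> \<otimes> (a\<^sup>\<star> \<otimes> y))"
    by (simp add: c_def star_mult mult_assoc)
  \<comment> \<open>The left side is \<open>w\<close> itself, so upward closure of \<open>F\<close>
    applies.\<close>
  moreover have "w \<otimes> (w\<^sup>\<star> \<otimes> w) \<preceq> w \<otimes> (w\<^sup>\<star> \<otimes> (a\<^sup>\<star> \<otimes> y))"
    using wa by (intro mult_left_mono) simp_all
  ultimately have "c\<^sup>\<star> \<otimes> y \<in> F"
    using sg_filter_up[OF F w] by simp
  moreover have "c \<preceq> a" by (simp add: c_def le_right_mult)
  moreover have "c \<preceq> b" by (simp add: cb le_right_mult)
  ultimately show ?thesis
    using that[of c] by (simp add: filter_act_def)
qed

end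

section \<open>Zero, meets and joins, and the existence of prime filters\<close>

context distributive_inverse_semigroup
begin

lemma is_zero_sg_zero: "is_zero A (sg_zero A)"
proof -
  obtain z where z: "is_zero A z" using zero_exists by blast
  then have "z' = z" if "is_zero A z'" for z' using that by (metis is_zero_def)
  then show ?thesis unfolding sg_zero_def using z by (metis theI)
qed

lemma zero_closed [simp]: "sg_zero A \<in> carrier A"
  and zero_mult [simp]: "a \<in> carrier A \<Longrightarrow> sg_zero A \<otimes> a = sg_zero A"
  and mult_zero [simp]: "a \<in> carrier A \<Longrightarrow> a \<otimes> sg_zero A = sg_zero A"
  using is_zero_sg_zero by (auto simp: is_zero_def)

lemma star_zero [simp]: "(sg_zero A)\<^sup>\<star> = sg_zero A"
  by (rule star_unique) simp_all

lemma star_one [simp]: "\<one>\<^sup>\<star> = \<one>"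
  by (rule star_unique) simp_all

lemma zero_le: "a \<in> carrier A \<Longrightarrow> sg_zero A \<preceq> a"
  using le_right_mult[OF _ idempotentsI[of "sg_zero A"], of a] by simp

lemma meet_props:
  assumes "a \<in> carrier A" "b \<in> carrier A"
  shows "sg_meet A a b \<in> carrier A" "sg_meet A a b \<preceq> a" "sg_meet A a b \<preceq> b"
    and "\<And>c. \<lbrakk>c \<in> carrier A; c \<preceq> a; c \<preceq> b\<rbrakk> \<Longrightarrow> c \<preceq> sg_meet A a b"
proof -
  have "greatest (natural_order A) (sg_meet A a b) (Lower (natural_order A) {a, b})"
    unfolding meet_def inf_def using meet_exists[OF assms] by (rule someI_ex)
  then show "sg_meet A a b \<in> carrier A" "sg_meet A a b \<preceq> a" "sg_meet A a b \<preceq> b"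
    and "\<And>c. \<lbrakk>c \<in> carrier A; c \<preceq> a; c \<preceq> b\<rbrakk> \<Longrightarrow> c \<preceq> sg_meet A a b"
    using assms by (auto simp: greatest_def Lower_def)
qed

lemma join_props:
  assumes "a \<in> carrier A" "b \<in> carrier A" "compatible A a b"
  shows "sg_join A a b \<in> carrier A" "a \<preceq> sg_join A a b" "b \<preceq> sg_join A a b"
    and "\<And>c. \<lbrakk>c \<in> carrier A; a \<preceq> c; b \<preceq> c\<rbrakk> \<Longrightarrow> sg_join A a b \<preceq> c"
proof -
  have "least (natural_order A) (sg_join A a b) (Upper (natural_order A) {a, b})"
    unfolding join_def sup_def using join_exists[OF assms] by (rule someI_ex)
  then show "sg_join A a b \<in> carrier A" "a \<preceq> sg_join A a b" "b \<preceq> sg_join A a b"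
    and "\<And>c. \<lbrakk>c \<in> carrier A; a \<preceq> c; b \<preceq> c\<rbrakk> \<Longrightarrow> sg_join A a b \<preceq> c"
    using assms by (auto simp: least_def Upper_def)
qed

text \<open>Inversion reverses products but is an order-preserving involution, so it carries joins
  to joins. It is needed because the action is defined through inverses.\<close>

lemma star_join:
  assumes ab [simp]: "a \<in> carrier A" "b \<in> carrier A" and c: "compatible A a b"
  shows "(sg_join A a b)\<^sup>\<star> = sg_join A (a\<^sup>\<star>) (b\<^sup>\<star>)"
proof (rule le_antisym)
  note j = join_props[OF ab c]
  note k = join_props[OF star_closed[OF ab(1)] star_closed[OF ab(2)] compatible_star[OF ab c]]
  show "(sg_join A a b)\<^sup>\<star> \<in> carrier A" "sg_join A (a\<^sup>\<star>) (b\<^sup>\<star>) \<in> carrier A"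
    using j k by simp_all
  show "(sg_join A a b)\<^sup>\<star> \<preceq> sg_join A (a\<^sup>\<star>) (b\<^sup>\<star>)"
    unfolding star_le_iff[OF j(1) k(1)]
    by (rule j(4)) (use k in \<open>simp_all flip: star_le_iff\<close>)
  show "sg_join A (a\<^sup>\<star>) (b\<^sup>\<star>) \<preceq> (sg_join A a b)\<^sup>\<star>"
    using j k star_mono by simp
qed

text \<open>Primality is pulled back along left multiplication by \<open>a\<^sup>\<star>\<close>,
  which preserves compatibility and joins and fixes the zero.\<close>

lemma prime_filter_act:
  assumes F: "prime_filter A F" and a [simp]: "a \<in> carrier A" and ne: "filter_act A a F \<noteq> {}"
  shows "prime_filter A (filter_act A a F)"
  unfolding prime_filter_def
proof (intro conjI ballI impI)
  show "sg_filter A (filter_act A a F)"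
    using prime_filter_sg_filter[OF F] a ne by (rule sg_filter_act)
  show "sg_zero A \<notin> filter_act A a F"
    using F by (simp add: filter_act_def prime_filter_def)
  fix x y assume xy: "x \<in> carrier A" "y \<in> carrier A" "compatible A x y"
    and "sg_join A x y \<in> filter_act A a F"
  then have "sg_join A (a\<^sup>\<star> \<otimes> x) (a\<^sup>\<star> \<otimes> y) \<in> F"
    by (simp add: filter_act_def mult_join_left)
  then have "a\<^sup>\<star> \<otimes> x \<in> F \<or> a\<^sup>\<star> \<otimes> y \<in> F"
    using F compatible_mult_left[of x y "a\<^sup>\<star>"] xy by (simp add: prime_filter_def)
  then show "x \<in> filter_act A a F \<or> y \<in> filter_act A a F"
    using xy by (simp add: filter_act_def)
qed

text \<open>This is the filter generated by \<open>M\<close> and \<open>x\<close>, with the meets of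
  \<open>x\<close> with members of \<open>M\<close> as a base. It may be improper.\<close>

lemma sg_filter_adjoin:
  assumes M: "sg_filter A M" and x [simp]: "x \<in> carrier A"
  shows "sg_filter A {z \<in> carrier A. \<exists>m\<in>M. sg_meet A m x \<preceq> z}" (is "sg_filter A ?N")
  unfolding sg_filter_def
proof (intro conjI ballI impI)
  note Mc = sg_filter_carrier[OF M]
  show "?N \<subseteq> carrier A" by auto
  obtain m where "m \<in> M" using M by (auto simp: sg_filter_def)
  then show "?N \<noteq> {}" using meet_props(2)[OF Mc x] Mc by auto
  show "z \<in> ?N" if "y \<in> ?N" "z \<in> carrier A" "y \<preceq> z" for y z
    using that le_trans by blast
  fix y z assume "y \<in> ?N" "z \<in> ?N"
  then obtain m n where yz: "y \<in> carrier A" "z \<in> carrier A"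
    and mn: "m \<in> M" "n \<in> M" "sg_meet A m x \<preceq> y" "sg_meet A n x \<preceq> z" by blast
  obtain w where w: "w \<in> M" "w \<in> carrier A" "w \<preceq> m" "w \<preceq> n"
    using sg_filter_directedE[OF M mn(1,2)] .
  note wx = meet_props[OF w(2) x]
  have "sg_meet A w x \<preceq> u" if "k \<in> M" "w \<preceq> k" "sg_meet A k x \<preceq> u" "u \<in> carrier A" for k u
    using le_trans[OF meet_props(4)[OF Mc[OF that(1)] x wx(1) _ wx(3)] that(3,4)]
      le_trans[OF wx(2) that(2) Mc[OF that(1)]] by blast
  moreover have "sg_meet A w x \<in> ?N" using wx w by auto
  ultimately show "\<exists>u\<in>?N. u \<preceq> y \<and> u \<preceq> z"
    using mn w yz by blast
qed

text \<open>This adapts the prime filter theorem for distributive lattices. Since the axioms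
  distribute multiplication, not meets, over joins, the primality argument replaces a meet with a
  join by a restriction of that join.\<close>

lemma prime_filter_separation:
  assumes a: "a \<in> carrier A" and b: "b \<in> carrier A" and nle: "\<not> a \<preceq> b"
  obtains F where "prime_filter A F" "a \<in> F" "b \<notin> F"
proof -
  define \<F> where "\<F> = {F. sg_filter A F \<and> a \<in> F \<and> b \<notin> F}"
  have "{y \<in> carrier A. a \<preceq> y} \<in> \<F>"
    using a nle principal_filter[OF a] by (simp add: \<F>_def)
  then have "\<F> \<noteq> {}" by blast
  moreover have "\<Union>C \<in> \<F>" if C: "C \<noteq> {}" "subset.chain \<F> C" for C
  proof -
    have "subset.chain (Collect (sg_filter A)) C"
      using C(2) by (auto simp: subset.chain_def \<F>_def)
    then show ?thesis
      using C sg_filter_Union_chain[of A C] by (auto simp: \<F>_def subset.chain_def)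
  qed
  ultimately obtain M where M: "M \<in> \<F>" and max: "\<And>N. N \<in> \<F> \<Longrightarrow> M \<subseteq> N \<Longrightarrow> N = M"
    using subset_Zorn_nonempty[of \<F>] by blast
  have filt: "sg_filter A M" and aM: "a \<in> M" and bM: "b \<notin> M" using M by (simp_all add: \<F>_def)
  note Mc = sg_filter_carrier[OF filt]
  \<comment> \<open>By maximality, adjoining an outside element \<open>x\<close> to \<open>M\<close>
    must capture \<open>b\<close>.\<close>
  have adj: "\<exists>m\<in>M. sg_meet A m x \<preceq> b" if x: "x \<in> carrier A" "x \<notin> M" for x
  proof (rule ccontr)
    let ?N = "{z \<in> carrier A. \<exists>m\<in>M. sg_meet A m x \<preceq> z}"
    assume "\<not> (\<exists>m\<in>M. sg_meet A m x \<preceq> b)"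
    moreover have "M \<subseteq> ?N" using meet_props(2)[OF Mc x(1)] Mc by blast
    ultimately have "?N = M"
      using aM by (intro max) (auto simp: \<F>_def sg_filter_adjoin[OF filt x(1)])
    moreover have "x \<in> ?N" using meet_props(3)[OF Mc[OF aM] x(1)] aM x by blast
    ultimately show False using x by blast
  qed
  have "x \<in> M \<or> y \<in> M" if xy [simp]: "x \<in> carrier A" "y \<in> carrier A" and c: "compatible A x y"
    and j: "sg_join A x y \<in> M" for x y
  proof (rule ccontr)
    assume "\<not> (x \<in> M \<or> y \<in> M)"
    then obtain m n where mn: "m \<in> M" "n \<in> M" "sg_meet A m x \<preceq> b" "sg_meet A n y \<preceq> b"
      using adj xy by blast
    obtain w where w: "w \<in> M" "w \<in> carrier A" "w \<preceq> m" "w \<preceq> n"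
      using sg_filter_directedE[OF filt mn(1,2)] .
    \<comment> \<open>Here \<open>w\<close> serves both \<open>m\<close> and \<open>n\<close>, and
      \<open>v\<close> is moreover below the join. The aim is \<open>v \<preceq> b\<close>, which
      contradicts \<open>b \<notin> M\<close>.\<close>
    obtain v where v: "v \<in> M" "v \<in> carrier A" "v \<preceq> w" "v \<preceq> sg_join A x y"
      using sg_filter_directedE[OF filt w(1) j] .
    obtain e where e: "e \<in> idempotents A" and ve: "v = sg_join A x y \<otimes> e" using v(4) leE by blast
    have e' [simp]: "e \<in> carrier A" using e by simp
    note jn = join_props[OF xy c]
    \<comment> \<open>For \<open>u\<close> equal to \<open>x\<close> or \<open>y\<close>, the
      restriction by \<open>e\<close> is below \<open>u\<close> and also below \<open>v\<close>,
      hence below \<open>k\<close>; so it is below their meet.\<close>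
    have below: "u \<otimes> e \<preceq> b"
      if u: "u \<in> carrier A" "u \<preceq> sg_join A x y" "k \<in> M" "w \<preceq> k" "sg_meet A k u \<preceq> b" for u k
    proof -
      have "u \<otimes> e \<preceq> v" unfolding ve using u jn by (intro mult_right_mono) simp_all
      then have "u \<otimes> e \<preceq> k" using v w u Mc le_trans by blast
      then have "u \<otimes> e \<preceq> sg_meet A k u"
        using meet_props(4)[OF Mc[OF u(3)] u(1)] le_right_mult[OF u(1) e] u by simp
      then show ?thesis using le_trans u b by blast
    qed
    \<comment> \<open>Distributivity splits \<open>v\<close> into two pieces, both below
      \<open>b\<close>.\<close>
    have "v = sg_join A (x \<otimes> e) (y \<otimes> e)"
      unfolding ve using c by (intro mult_join_right) simp_all
    moreover have "sg_join A (x \<otimes> e) (y \<otimes> e) \<preceq> b"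
      using below[of x m] below[of y n] mn w jn b c
      by (intro join_props(4) compatible_mult_right) simp_all
    ultimately show False using sg_filter_up[OF filt v(1)] b bM by simp
  qed
  moreover have "sg_zero A \<notin> M"
    using sg_filter_up[OF filt _ zero_le[OF b] b] bM by blast
  ultimately have "prime_filter A M" using filt by (simp add: prime_filter_def)
  then show ?thesis using that aM bM by blast
qed

section \<open>The representation on prime filters\<close>

lemma filter_rep_iff:
  "(F, G) \<in> filter_rep A a \<longleftrightarrow>
    prime_filter A F \<and> G = filter_act A a F \<and> G \<noteq> {}"
  by (simp add: filter_rep_def)

lemma filter_rep_closed:
  assumes a: "a \<in> carrier A"
  shows "filter_rep A a \<in> partial_bijections (Collect (prime_filter A))"
proof -
  have "F = F'" if "(F, G) \<in> filter_rep A a" "(F', G) \<in> filter_rep A a" for F F' G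
  proof -
    have "sg_filter A F" "sg_filter A F'" "filter_act A a F = filter_act A a F'"
      "filter_act A a F \<noteq> {}" "filter_act A a F' \<noteq> {}"
      using that unfolding filter_rep_iff by (metis prime_filter_sg_filter)+
    then show ?thesis using filter_act_inj a by (intro subset_antisym) simp_all
  qed
  moreover have "filter_rep A a \<subseteq> Collect (prime_filter A) \<times> Collect (prime_filter A)"
    by (rule subrelI) (metis SigmaI a filter_rep_iff mem_Collect_eq prime_filter_act)
  moreover have "single_valued (filter_rep A a)"
    by (rule single_valuedI) (simp add: filter_rep_iff)
  ultimately show ?thesis
    unfolding partial_bijections_def by (simp add: single_valued_def)
qed

lemma filter_rep_mult:
  assumes ab: "a \<in> carrier A" "b \<in> carrier A"
  shows "filter_rep A (a \<otimes> b) = filter_rep A b O filter_rep A a"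
proof -
  \<comment> \<open>This matches the domains: where \<open>b\<close> is undefined, so is the
    product.\<close>
  have [simp]: "filter_act A a {} = {}" by (simp add: filter_act_def)
  show ?thesis
    using ab by (auto simp: filter_rep_iff filter_act_mult relcomp_unfold intro: prime_filter_act)
qed

lemma filter_rep_zero: "filter_rep A (sg_zero A) = {}"
  by (auto simp: filter_rep_def filter_act_def prime_filter_def)

lemma filter_rep_one: "filter_rep A \<one> = Id_on (Collect (prime_filter A))"
proof -
  have "filter_act A \<one> F = F \<and> F \<noteq> {}" if "prime_filter A F" for F
    using prime_filter_sg_filter[OF that] by (auto simp: filter_act_def sg_filter_def)
  then show ?thesis by (auto simp: filter_rep_iff Id_on_iff)
qed

lemma filter_rep_mono:
  assumes "a \<preceq> b" "a \<in> carrier A" "b \<in> carrier A"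
  shows "filter_rep A a \<subseteq> filter_rep A b"
  using filter_act_mono[OF prime_filter_sg_filter] assms by (auto simp: filter_rep_iff)

text \<open>Only the second inclusion has content. If \<open>a\<close> and \<open>b\<close> send
  \<open>F\<close> to the same filter, any \<open>y\<close> in it yields a common lower bound
  \<open>c\<close> still defined at \<open>F\<close>; then \<open>c\<close> lies below the meet, and
  monotonicity finishes.\<close>

lemma filter_rep_meet:
  assumes ab [simp]: "a \<in> carrier A" "b \<in> carrier A"
  shows "filter_rep A (sg_meet A a b) = filter_rep A a \<inter> filter_rep A b"
proof
  note m = meet_props[OF ab]
  show "filter_rep A (sg_meet A a b) \<subseteq> filter_rep A a \<inter> filter_rep A b"
    using m filter_rep_mono by simp
  show "filter_rep A a \<inter> filter_rep A b \<subseteq> filter_rep A (sg_meet A a b)"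
  proof
    fix p assume "p \<in> filter_rep A a \<inter> filter_rep A b"
    then obtain F G y where p: "p = (F, G)" "prime_filter A F" "G = filter_act A a F"
      "G = filter_act A b F" "y \<in> G"
      by (cases p) (auto simp: filter_rep_iff)
    then obtain c where c: "c \<in> carrier A" "c \<preceq> a" "c \<preceq> b" "y \<in> filter_act A c F"
      using filter_act_common_lower[OF prime_filter_sg_filter[OF p(2)] ab, of y] by blast
    have "(F, G) \<in> filter_rep A c"
      using filter_act_mono[OF prime_filter_sg_filter[OF p(2)] c(2,1)] c p
      by (auto simp: filter_rep_iff)
    then show "p \<in> filter_rep A (sg_meet A a b)"
      using filter_rep_mono[OF m(4)] c m(1) p(1) by blast
  qed
qed

text \<open>If the join is defined at \<open>F\<close>, distributivity puts a join of
  \<open>a\<^sup>\<star> \<otimes> y\<close> and \<open>b\<^sup>\<star> \<otimes> y\<close> into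
  \<open>F\<close>. Primality makes \<open>a\<close> or \<open>b\<close> defined there, and
  \<open>filter_act_mono\<close> forces its value to agree with that of the join.\<close>

lemma filter_rep_join:
  assumes ab [simp]: "a \<in> carrier A" "b \<in> carrier A" and c: "compatible A a b"
  shows "filter_rep A (sg_join A a b) = filter_rep A a \<union> filter_rep A b"
proof
  note j = join_props[OF ab c]
  show "filter_rep A a \<union> filter_rep A b \<subseteq> filter_rep A (sg_join A a b)"
    using j filter_rep_mono by simp
  show "filter_rep A (sg_join A a b) \<subseteq> filter_rep A a \<union> filter_rep A b"
  proof
    fix p assume "p \<in> filter_rep A (sg_join A a b)"
    then obtain F y where F: "p = (F, filter_act A (sg_join A a b) F)" "prime_filter A F"
      and y [simp]: "y \<in> carrier A" and jy: "(sg_join A a b)\<^sup>\<star> \<otimes> y \<in> F"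
      by (cases p) (auto simp: filter_rep_iff filter_act_def)
    have "sg_join A (a\<^sup>\<star> \<otimes> y) (b\<^sup>\<star> \<otimes> y) \<in> F"
      using jy c by (simp add: star_join mult_join_right compatible_star)
    then have "a\<^sup>\<star> \<otimes> y \<in> F \<or> b\<^sup>\<star> \<otimes> y \<in> F"
      using F(2) compatible_mult_right[OF _ _ y compatible_star[OF ab c]]
      by (simp add: prime_filter_def)
    then have "filter_act A a F \<noteq> {} \<or> filter_act A b F \<noteq> {}"
      by (auto simp: filter_act_def)
    then show "p \<in> filter_rep A a \<union> filter_rep A b"
      using filter_act_mono[OF prime_filter_sg_filter[OF F(2)] j(2) _ j(1)]
        filter_act_mono[OF prime_filter_sg_filter[OF F(2)] j(3) _ j(1)] F
      by (auto simp: filter_rep_iff)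
  qed
qed

text \<open>The representation reflects the order, so equal images give inequalities both ways and
  injectivity follows by antisymmetry.\<close>

lemma filter_rep_le_imp_le:
  assumes [simp]: "a \<in> carrier A" "b \<in> carrier A" and sub: "filter_rep A a \<subseteq> filter_rep A b"
  shows "a \<preceq> b"
proof (rule ccontr)
  assume "\<not> a \<preceq> b"
  then obtain F where F: "prime_filter A F" "a \<in> F" "b \<notin> F"
    using prime_filter_separation[of a b] by auto
  define E where "E = filter_act A (a\<^sup>\<star>) F"
  \<comment> \<open>Unfolded, this asks for
    \<open>a \<otimes> (a\<^sup>\<star> \<otimes> a) = a\<close> to lie in \<open>F\<close>.\<close>
  have aE: "a\<^sup>\<star> \<otimes> a \<in> E" using F by (simp add: E_def filter_act_def)
  then have E: "prime_filter A E"
    unfolding E_def using F by (intro prime_filter_act) auto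
  note Ef = prime_filter_sg_filter[OF E]
  have "a \<in> filter_act A a E" using aE by (simp add: filter_act_def)
  then have "(E, filter_act A a E) \<in> filter_rep A a"
    using E by (auto simp: filter_rep_iff)
  then have "(E, filter_act A a E) \<in> filter_rep A b" using sub by blast
  then have ab: "filter_act A a E = filter_act A b E" by (simp add: filter_rep_iff)
  then have "b\<^sup>\<star> \<otimes> a \<in> E" using \<open>a \<in> filter_act A a E\<close> by (simp add: filter_act_def)
  then obtain w where w: "w \<in> E" "w \<in> carrier A" "w \<preceq> a\<^sup>\<star> \<otimes> a" "w \<preceq> b\<^sup>\<star> \<otimes> a"
    using sg_filter_directedE[OF Ef aE] by blast
  \<comment> \<open>Being idempotent and fixed by \<open>b\<^sup>\<star> \<otimes> b\<close>, the
    element \<open>w\<close> is a restriction of it. So \<open>E\<close> contains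
    \<open>b\<^sup>\<star> \<otimes> b\<close>, and \<open>b\<close> lies in its own image of
    \<open>E\<close>.\<close>
  have "w \<in> idempotents A" using le_idem[OF w(3)] by simp
  then have "b\<^sup>\<star> \<otimes> b \<otimes> w \<preceq> b\<^sup>\<star> \<otimes> b" by (intro le_right_mult) simp_all
  then have "w \<preceq> b\<^sup>\<star> \<otimes> b"
    using le_star_mult_absorb[OF w(4)] w(2) by (simp add: mult_assoc)
  then have "b\<^sup>\<star> \<otimes> b \<in> E" using sg_filter_up[OF Ef w(1)] by simp
  \<comment> \<open>The assumed agreement at \<open>E\<close> moves \<open>b\<close> into the image
    under \<open>a\<close>; unfolding both actions leads back to \<open>F\<close>.\<close>
  then have "b \<in> filter_act A a E" by (simp add: ab) (simp add: filter_act_def)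
  then have "a \<otimes> (a\<^sup>\<star> \<otimes> b) \<in> F" by (simp add: E_def filter_act_def)
  then have "b \<in> F"
    using sg_filter_up[OF prime_filter_sg_filter[OF F(1)] _ mult_star_mult_le[of a b]] by simp
  then show False using F by simp
qed

lemma filter_rep_inj: "inj_on (filter_rep A) (carrier A)"
  by (rule inj_onI) (simp add: filter_rep_le_imp_le le_antisym)

lemma filter_rep_hom:
  "distributive_inverse_semigroup_hom A (sym_inv_semigroup (Collect (prime_filter A))) (filter_rep A)"
proof (intro distributive_inverse_semigroup_hom.intro
    distributive_inverse_semigroup_hom_axioms.intro)
  show "distributive_inverse_semigroup A" ..
  show "distributive_inverse_semigroup (sym_inv_semigroup (Collect (prime_filter A)))"
    by (rule sym_inv_distributive_inverse_semigroup)
  fix a b assume ab: "a \<in> carrier A" "b \<in> carrier A"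
  show "filter_rep A (sg_meet A a b) =
      sg_meet (sym_inv_semigroup (Collect (prime_filter A))) (filter_rep A a) (filter_rep A b)"
    using ab by (simp add: filter_rep_meet sym_inv_meet filter_rep_closed)
  assume c: "compatible A a b"
  show "filter_rep A (sg_join A a b) =
      sg_join (sym_inv_semigroup (Collect (prime_filter A))) (filter_rep A a) (filter_rep A b)"
    using ab c filter_rep_closed[OF join_props(1)[OF ab c]]
    by (simp add: filter_rep_join sym_inv_join filter_rep_closed)
qed (auto simp: hom_def filter_rep_closed filter_rep_mult filter_rep_zero filter_rep_one
    sym_inv_zero)

end

theorem corollary3p24:
  fixes A :: "('a, 'b) monoid_scheme"
  assumes "distributive_inverse_semigroup A"
  shows "\<exists>(X :: 'a set set) \<rho>.
           distributive_inverse_semigroup_hom A (sym_inv_semigroup X) \<rho> \<and> inj_on \<rho> (carrier A)"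
  using distributive_inverse_semigroup.filter_rep_hom[OF assms]
    distributive_inverse_semigroup.filter_rep_inj[OF assms] by blast

end
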